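(* Let $f:\mathrm{Dom}\,f\to\mathrm{Range}\,f$ be a set function, $\mathcal X$ a family of non-empty subsets of $\mathrm{Dom}\,f$ and $\mathcal Y$ a family of non-empty subsets of $\mathrm{Range}\,f$. If $B\subseteq\mathrm{Im}\,f$, then $$B\in f[\mathcal X]\iff\bigcup f^{\leftarrow}B\in\mathcal X.$$ If $f$ is injective, then for $A\subseteq\mathrm{Dom}\,f$ $$A\in f^{-1}[\mathcal Y]\iff\bigcap f^{\rightarrow}A\in\mathcal Y.$$
   Context: $\mathrm{Im}\,f$ is the image of $f$. The direct image $f[\mathcal X]$ of a family $\mathcal X$ of subsets of the domain is the collection of all $B\subseteq\mathrm{Range}\,f$ such that $f^{-1}B\in\mathcal X$ ($f^{-1}B$ the preimage of $B$). The direct inverse image $f^{-1}[\mathcal Y]$ of a family $\mathcal Y$ of subsets of the range is the collection of all $A\subseteq\mathrm{Dom}\,f$ such that $fA\in\mathcal Y$ ($fA$ the image of $A$). $f^{\rightarrow}A$ is the collection of all subsets of $\mathrm{Range}\,f$ whose preimage is $A$, and $f^{\leftarrow}B$ is the collection of all subsets of $\mathrm{Dom}\,f$ whose image is $B$. *)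

theory Defs
  imports "HOL-Library.FuncSet"
begin

text \<open>A map from the set \<open>D\<close> (its domain) to the set \<open>R\<close> (its codomain, called Range in the
  source; not necessarily the image) is a total function \<open>f\<close> with \<open>f \<in> D \<rightarrow> R\<close>.
  Since values of \<open>f\<close> outside \<open>D\<close> are irrelevant, preimages are cut down to \<open>D\<close>.

  In the usual notation, \<open>sets_with_preimage D R f A\<close> is \<open>f\<^sup>\<rightarrow> A\<close> and
  \<open>sets_with_image D f B\<close> is \<open>f\<^sup>\<leftarrow> B\<close>.\<close>

definition preimage_on :: "'a set \<Rightarrow> ('a \<Rightarrow> 'b) \<Rightarrow> 'b set \<Rightarrow> 'a set" where
  "preimage_on D f B = f -` B \<inter> D"

definition direct_image :: "'a set \<Rightarrow> 'b set \<Rightarrow> ('a \<Rightarrow> 'b) \<Rightarrow> 'a set set \<Rightarrow> 'b set set" where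
  "direct_image D R f \<X> = {B. B \<subseteq> R \<and> preimage_on D f B \<in> \<X>}"

definition direct_inverse_image :: "'a set \<Rightarrow> ('a \<Rightarrow> 'b) \<Rightarrow> 'b set set \<Rightarrow> 'a set set" where
  "direct_inverse_image D f \<Y> = {A. A \<subseteq> D \<and> f ` A \<in> \<Y>}"

definition sets_with_preimage :: "'a set \<Rightarrow> 'b set \<Rightarrow> ('a \<Rightarrow> 'b) \<Rightarrow> 'a set \<Rightarrow> 'b set set" where
  "sets_with_preimage D R f A = {B. B \<subseteq> R \<and> preimage_on D f B = A}"

definition sets_with_image :: "'a set \<Rightarrow> ('a \<Rightarrow> 'b) \<Rightarrow> 'b set \<Rightarrow> 'a set set" where
  "sets_with_image D f B = {A. A \<subseteq> D \<and> f ` A = B}"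

end

theory Submission
  imports Defs
begin

text \<open>
  Both equivalences hold because the preimage and the image are extremal members of the two
  families. The preimage of \<open>B\<close> contains every subset of \<open>D\<close> that \<open>f\<close> maps into \<open>B\<close>, and
  when \<open>B\<close> lies in the image of \<open>f\<close> it is mapped onto \<open>B\<close>; so it is the largest member, and
  hence the union, of the sets with image \<open>B\<close>. Dually, \<open>f ` A\<close> lies in every set with
  preimage \<open>A\<close>, and when \<open>f\<close> is injective it has preimage exactly \<open>A\<close>; so it is the smallest
  member, and hence the intersection, of the sets with preimage \<open>A\<close>.
\<close>

lemma Union_sets_with_image:
  assumes "B \<subseteq> f ` D"
  shows "\<Union> (sets_with_image D f B) = preimage_on D f B"
proof
  show "\<Union> (sets_with_image D f B) \<subseteq> preimage_on D f B"
    by (auto simp: sets_with_image_def preimage_on_def)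
  have "preimage_on D f B \<in> sets_with_image D f B"
    using assms by (auto simp: sets_with_image_def preimage_on_def)
  then show "preimage_on D f B \<subseteq> \<Union> (sets_with_image D f B)"
    by blast
qed

text \<open>
  Injectivity also guarantees that the family is non-empty. If two points of \<open>D\<close> had the same
  value and \<open>A\<close> contained only one of them, no set would have preimage \<open>A\<close> and the
  intersection would be the whole type.
\<close>

lemma Inter_sets_with_preimage:
  assumes "f \<in> D \<rightarrow> R" and "inj_on f D" and "A \<subseteq> D"
  shows "\<Inter> (sets_with_preimage D R f A) = f ` A"
proof
  have "f ` A \<subseteq> R"
    using assms by auto
  moreover have "preimage_on D f (f ` A) = A"
    using assms by (auto simp: preimage_on_def dest: inj_onD)
  ultimately have "f ` A \<in> sets_with_preimage D R f A"
    by (simp add: sets_with_preimage_def)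
  then show "\<Inter> (sets_with_preimage D R f A) \<subseteq> f ` A"
    by blast
  show "f ` A \<subseteq> \<Inter> (sets_with_preimage D R f A)"
    by (auto simp: sets_with_preimage_def preimage_on_def)
qed

theorem theorem11p4:
  fixes f :: "'a \<Rightarrow> 'b" and D :: "'a set" and R :: "'b set"
    and \<X> :: "'a set set" and \<Y> :: "'b set set"
  assumes "f \<in> D \<rightarrow> R"
    and "\<forall>A\<in>\<X>. A \<subseteq> D \<and> A \<noteq> {}"
    and "\<forall>B\<in>\<Y>. B \<subseteq> R \<and> B \<noteq> {}"
  shows "(\<forall>B. B \<subseteq> f ` D \<longrightarrow>
            (B \<in> direct_image D R f \<X> \<longleftrightarrow> \<Union> (sets_with_image D f B) \<in> \<X>)) \<and>
         (inj_on f D \<longrightarrow>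
            (\<forall>A. A \<subseteq> D \<longrightarrow>
              (A \<in> direct_inverse_image D f \<Y> \<longleftrightarrow> \<Inter> (sets_with_preimage D R f A) \<in> \<Y>)))"
proof (intro conjI allI impI)
  fix B
  assume B: "B \<subseteq> f ` D"
  with assms(1) have "B \<subseteq> R"
    by auto
  then show "B \<in> direct_image D R f \<X> \<longleftrightarrow> \<Union> (sets_with_image D f B) \<in> \<X>"
    by (simp add: direct_image_def Union_sets_with_image[OF B])
next
  fix A
  assume "inj_on f D" and A: "A \<subseteq> D"
  then show "A \<in> direct_inverse_image D f \<Y> \<longleftrightarrow> \<Inter> (sets_with_preimage D R f A) \<in> \<Y>"
    by (simp add: direct_inverse_image_def Inter_sets_with_preimage[OF assms(1)])
qed

end
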